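(* Let $t\in\{0,\dots,T-1\}$ and let $(\mathfrak{F},\mathfrak{E}_t)$ be a consistent pair generated by some regular driver, i.e. $\mathfrak{F}$ is the zero hedging function of that driver and $\mathfrak{E}_t$ its set of time $t$ endpoints. Then there is a unique function $F(\omega,t,\cdot,\cdot)$ associated with $(\mathfrak{F},\mathfrak{E}_t)$, that is, such that $F(\omega,t,Y_t,Z_t)$ is the value at time $t$, for given $Y_t$ and $Z_t$, of a driver generating $\mathfrak{F}$ and $\mathfrak{E}_t$: if $F$ and $\tilde F$ are regular drivers both having zero hedging function $\mathfrak{F}$ and set of time $t$ endpoints $\mathfrak{E}_t$, then $F(\omega,t,Y_t,Z_t)=\tilde F(\omega,t,Y_t,Z_t)$ $\mathbb{P}$-a.s. for all $Y_t\in L^\infty(\mathcal{F}_t;\mathbb{R}^K)$ and $Z_t\in L^\infty(\mathcal{F}_t;\mathbb{R}^{K\times N})$.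
   Context: Setting. $N,K\ge 1$ are integers and $T\geq 1$ is a deterministic integer. $X=(X_t)_{0\le t\le T}$ is a process on a probability space $(\Omega,\mathcal{F},\mathbb{P})$ with values in the standard basis (column) vectors $\{e_1,\dots,e_N\}$ of $\mathbb{R}^N$, and $\mathcal{F}_t$ is the completion of the $\sigma$-algebra generated by $X_0,\dots,X_t$. Put $M_t:=X_t-E[X_t\mid\mathcal{F}_{t-1}]$ for $1\le t\le T$. All adapted processes $Y$ ($\mathbb{R}^K$-valued) and $Z$ ($\mathbb{R}^{K\times N}$-valued) have $Y_t,Z_t\in L^\infty(\mathcal{F}_t)$; random variables are identified when $\mathbb{P}$-a.s. equal. Driver. A driver is an adapted map $F:\Omega\times\{0,\dots,T\}\times\mathbb{R}^K\times\mathbb{R}^{K\times N}\to\mathbb{R}^K$ with $F(\omega,t,Y_t,Z_t)\in L^\infty(\mathcal{F}_t)$ for all $t$ and all $Y_t,Z_t\in L^\infty(\mathcal{F}_t)$. Equivalence. $Z^1\sim_M Z^2$ means $Z^1_uM_{u+1}=Z^2_uM_{u+1}$ $\mathbb{P}$-a.s. for all $u\in\{0,\dots,T-1\}$. A driver $F$ is called regular here if (a) for any adapted $Y$, $Z^1\sim_MZ^2$ implies $F(\omega,t,Y_t,Z^1_t)=F(\omega,t,Y_t,Z^2_t)$ $\mathbb{P}$-a.s. for all $t\in\{0,\dots,T-1\}$; and (b) for any adapted $Z$ and all $t\in\{0,\dots,T-1\}$, the map $Y_t\mapsto Y_t-F(\omega,t,Y_t,Z_t)$ is $\mathbb{P}$-a.s.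 a bijection of $\mathbb{R}^K$, up to equality $\mathbb{P}$-a.s. (i.e. it is a bijection of the set of $\mathbb{R}^K$-valued $\mathcal{F}_t$-measurable random variables, identified when a.s. equal, onto itself). BSDE. For a driver $F$ and $Q\in L^\infty(\mathcal{F}_T;\mathbb{R}^K)$, a solution of the BSDE is a pair of adapted processes $(Y,Z)$ with $Y_t-\sum_{t\le u<T}F(\omega,u,Y_u,Z_u)+\sum_{t\le u<T}Z_uM_{u+1}=Q$ $\mathbb{P}$-a.s. for all $t\in\{0,\dots,T\}$. For regular $F$ a solution exists and is unique up to indistinguishability of $Y$ and $\sim_M$ for $Z$. Endpoints. For a regular driver $F$, the set of time $t$ endpoints is $\mathfrak{E}_t:=\{(Y_t,Q)\mid Q\in L^\infty(\mathcal{F}_T;\mathbb{R}^K)\}$, where $Y_t$ is the time $t$ value of the solution to the BSDE with driver $F$ and terminal condition $Q$. Zero hedging function. For a regular driver $F$, its zero hedging function is $\mathfrak{F}(\omega,t,Y_t):=F(\omega,t,Y_t,0)$. Consistency. A pair $(\mathfrak{F},\mathfrak{E}_t)$ is consistent if for any initial value $Y_t\in L^\infty(\mathcal{F}_t)$, the pair $(Y_t,Y_T)$ belongs to $\mathfrak{E}_t$, where $Y_T$ is obtained from $Y_t$ by the recursion $Y_{u+1}=Y_u-\mathfrak{F}(\omega,u,Y_u)$, $t\le u<T$. *)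

theory Defs
  imports "HOL-Probability.Probability"
begin

text \<open>
  Throughout, \<open>P\<close> is the probability space \<open>(\<Omega>, F, P)\<close>, \<open>X\<close> the state process and \<open>T\<close> the terminal
  time. The index type \<open>'n\<close> has \<open>N\<close> elements and \<open>'k\<close> has \<open>K\<close> elements; matrices with \<open>K\<close> rows and
  \<open>N\<close> columns have type \<open>real^'n^'k\<close>. Time indices are meant to range over \<open>{0..T}\<close>.
\<close>

text \<open>
  Completion of the \<open>\<sigma>\<close>-algebra generated by \<open>X\<^sub>0, \<dots>, X\<^sub>t\<close>: all subsets of \<open>P\<close>-null sets are adjoined.
  As \<open>P\<close> itself need not be complete, this is a sub-\<open>\<sigma>\<close>-algebra of \<open>completion P\<close>; it contains every
  almost sure modification of its measurable functions. Only the measurable sets of this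
  measure are meaningful, its measure function is not used.
\<close>
definition filt :: "'a measure \<Rightarrow> (nat \<Rightarrow> 'a \<Rightarrow> real^'n) \<Rightarrow> nat \<Rightarrow> 'a measure" where
  "filt P X t = sigma (space P)
     ({X s -` B \<inter> space P | s B. s \<le> t \<and> B \<in> sets borel} \<union> null_sets (completion P))"

definition Linfty :: "'a measure \<Rightarrow> (nat \<Rightarrow> 'a \<Rightarrow> real^'n) \<Rightarrow> nat \<Rightarrow> ('a \<Rightarrow> 'b::real_normed_vector) set" where
  "Linfty P X t = {Y \<in> borel_measurable (filt P X t). \<exists>C. AE \<omega> in P. norm (Y \<omega>) \<le> C}"

definition adapted_process ::
  "'a measure \<Rightarrow> (nat \<Rightarrow> 'a \<Rightarrow> real^'n) \<Rightarrow> nat \<Rightarrow> (nat \<Rightarrow> 'a \<Rightarrow> 'b::real_normed_vector) \<Rightarrow> bool" where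
  "adapted_process P X T Y \<longleftrightarrow> (\<forall>t\<le>T. Y t \<in> Linfty P X t)"

text \<open>
  \<open>M\<^sub>t = X\<^sub>t - E[X\<^sub>t | F\<^sub>t\<^sub>-\<^sub>1]\<close>, with the conditional expectation taken componentwise.
  It is only used for \<open>t \<ge> 1\<close>.
\<close>
definition mart_diff ::
  "'a measure \<Rightarrow> (nat \<Rightarrow> 'a \<Rightarrow> real^'n) \<Rightarrow> nat \<Rightarrow> 'a \<Rightarrow> real^'n" where
  "mart_diff P X t \<omega> =
     X t \<omega> - (\<chi> i. real_cond_exp (completion P) (filt P X (t - 1)) (\<lambda>\<omega>'. X t \<omega>' $ i) \<omega>)"

definition driver ::
  "'a measure \<Rightarrow> (nat \<Rightarrow> 'a \<Rightarrow> real^'n) \<Rightarrow> nat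
    \<Rightarrow> ('a \<Rightarrow> nat \<Rightarrow> real^'k \<Rightarrow> real^'n^'k \<Rightarrow> real^'k) \<Rightarrow> bool" where
  "driver P X T F \<longleftrightarrow>
     (\<forall>t\<le>T. \<forall>y z. (\<lambda>\<omega>. F \<omega> t y z) \<in> borel_measurable (filt P X t)) \<and>
     (\<forall>t\<le>T. \<forall>Y\<in>Linfty P X t. \<forall>Z\<in>Linfty P X t. (\<lambda>\<omega>. F \<omega> t (Y \<omega>) (Z \<omega>)) \<in> Linfty P X t)"

definition M_equiv ::
  "'a measure \<Rightarrow> (nat \<Rightarrow> 'a \<Rightarrow> real^'n) \<Rightarrow> nat
    \<Rightarrow> (nat \<Rightarrow> 'a \<Rightarrow> real^'n^'k) \<Rightarrow> (nat \<Rightarrow> 'a \<Rightarrow> real^'n^'k) \<Rightarrow> bool" where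
  "M_equiv P X T Z1 Z2 \<longleftrightarrow>
     (\<forall>u<T. AE \<omega> in P. Z1 u \<omega> *v mart_diff P X (u + 1) \<omega> = Z2 u \<omega> *v mart_diff P X (u + 1) \<omega>)"

text \<open>
  \<open>\<Phi>\<close> induces a bijection of \<open>A\<close> modulo almost sure equality onto itself: it maps \<open>A\<close> into \<open>A\<close>, the
  map induced on classes is well defined and injective (the two directions of the
  equivalence), and it is surjective.
\<close>
definition bij_mod_AE :: "'a measure \<Rightarrow> ('a \<Rightarrow> 'b) set \<Rightarrow> (('a \<Rightarrow> 'b) \<Rightarrow> ('a \<Rightarrow> 'b)) \<Rightarrow> bool" where
  "bij_mod_AE P A \<Phi> \<longleftrightarrow>
     (\<forall>Y\<in>A. \<Phi> Y \<in> A) \<and>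
     (\<forall>Y\<in>A. \<forall>Y'\<in>A. (AE \<omega> in P. \<Phi> Y \<omega> = \<Phi> Y' \<omega>) \<longleftrightarrow> (AE \<omega> in P. Y \<omega> = Y' \<omega>)) \<and>
     (\<forall>W\<in>A. \<exists>Y\<in>A. AE \<omega> in P. \<Phi> Y \<omega> = W \<omega>)"

definition regular_driver ::
  "'a measure \<Rightarrow> (nat \<Rightarrow> 'a \<Rightarrow> real^'n) \<Rightarrow> nat
    \<Rightarrow> ('a \<Rightarrow> nat \<Rightarrow> real^'k \<Rightarrow> real^'n^'k \<Rightarrow> real^'k) \<Rightarrow> bool" where
  "regular_driver P X T F \<longleftrightarrow>
     driver P X T F \<and>
     (\<forall>Y Z1 Z2. adapted_process P X T Y \<and> adapted_process P X T Z1 \<and> adapted_process P X T Z2 \<and>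
        M_equiv P X T Z1 Z2 \<longrightarrow>
        (\<forall>t<T. AE \<omega> in P. F \<omega> t (Y t \<omega>) (Z1 t \<omega>) = F \<omega> t (Y t \<omega>) (Z2 t \<omega>))) \<and>
     (\<forall>Z. adapted_process P X T Z \<longrightarrow>
        (\<forall>t<T. bij_mod_AE P (borel_measurable (filt P X t))
                 (\<lambda>Y \<omega>. Y \<omega> - F \<omega> t (Y \<omega>) (Z t \<omega>))))"

definition bsde_solution ::
  "'a measure \<Rightarrow> (nat \<Rightarrow> 'a \<Rightarrow> real^'n) \<Rightarrow> nat
    \<Rightarrow> ('a \<Rightarrow> nat \<Rightarrow> real^'k \<Rightarrow> real^'n^'k \<Rightarrow> real^'k) \<Rightarrow> ('a \<Rightarrow> real^'k)
    \<Rightarrow> (nat \<Rightarrow> 'a \<Rightarrow> real^'k) \<Rightarrow> (nat \<Rightarrow> 'a \<Rightarrow> real^'n^'k) \<Rightarrow> bool" where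
  "bsde_solution P X T F Q Y Z \<longleftrightarrow>
     adapted_process P X T Y \<and> adapted_process P X T Z \<and>
     (\<forall>t\<le>T. AE \<omega> in P.
        Y t \<omega> - (\<Sum>u\<in>{t..<T}. F \<omega> u (Y u \<omega>) (Z u \<omega>))
              + (\<Sum>u\<in>{t..<T}. Z u \<omega> *v mart_diff P X (u + 1) \<omega>) = Q \<omega>)"

text \<open>
  The set consists of pairs of representatives and is closed under almost sure modification of
  either component, so equality of such sets is equality of the sets of pairs of classes.
\<close>
definition endpoints ::
  "'a measure \<Rightarrow> (nat \<Rightarrow> 'a \<Rightarrow> real^'n) \<Rightarrow> nat
    \<Rightarrow> ('a \<Rightarrow> nat \<Rightarrow> real^'k \<Rightarrow> real^'n^'k \<Rightarrow> real^'k) \<Rightarrow> nat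
    \<Rightarrow> (('a \<Rightarrow> real^'k) \<times> ('a \<Rightarrow> real^'k)) set" where
  "endpoints P X T F t =
     {(Y t, Q) | Y Z Q. Q \<in> Linfty P X T \<and> bsde_solution P X T F Q Y Z}"

text \<open>
  \<open>H\<close> is the function \<open>(\<omega>, u, Y\<^sub>u) \<mapsto> F(\<omega>, u, Y\<^sub>u, 0)\<close>, up to almost sure equality of the random
  variables obtained by inserting any \<open>Y\<^sub>u \<in> L\<^sup>\<infinity>(F\<^sub>u)\<close>.
\<close>
definition is_zero_hedging_function ::
  "'a measure \<Rightarrow> (nat \<Rightarrow> 'a \<Rightarrow> real^'n) \<Rightarrow> nat
    \<Rightarrow> ('a \<Rightarrow> nat \<Rightarrow> real^'k \<Rightarrow> real^'n^'k \<Rightarrow> real^'k)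
    \<Rightarrow> ('a \<Rightarrow> nat \<Rightarrow> real^'k \<Rightarrow> real^'k) \<Rightarrow> bool" where
  "is_zero_hedging_function P X T F H \<longleftrightarrow>
     (\<forall>u\<le>T. \<forall>Y\<in>Linfty P X u. AE \<omega> in P. H \<omega> u (Y \<omega>) = F \<omega> u (Y \<omega>) 0)"

definition generates ::
  "'a measure \<Rightarrow> (nat \<Rightarrow> 'a \<Rightarrow> real^'n) \<Rightarrow> nat \<Rightarrow> nat
    \<Rightarrow> ('a \<Rightarrow> nat \<Rightarrow> real^'k \<Rightarrow> real^'n^'k \<Rightarrow> real^'k)
    \<Rightarrow> ('a \<Rightarrow> nat \<Rightarrow> real^'k \<Rightarrow> real^'k) \<Rightarrow> (('a \<Rightarrow> real^'k) \<times> ('a \<Rightarrow> real^'k)) set \<Rightarrow> bool" where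
  "generates P X T t F H E \<longleftrightarrow>
     regular_driver P X T F \<and> is_zero_hedging_function P X T F H \<and> endpoints P X T F t = E"

definition consistent_pair ::
  "'a measure \<Rightarrow> (nat \<Rightarrow> 'a \<Rightarrow> real^'n) \<Rightarrow> nat \<Rightarrow> nat
    \<Rightarrow> ('a \<Rightarrow> nat \<Rightarrow> real^'k \<Rightarrow> real^'k) \<Rightarrow> (('a \<Rightarrow> real^'k) \<times> ('a \<Rightarrow> real^'k)) set \<Rightarrow> bool" where
  "consistent_pair P X T t H E \<longleftrightarrow>
     (\<forall>Y. Y t \<in> Linfty P X t \<and> (\<forall>u\<in>{t..<T}. Y (u + 1) = (\<lambda>\<omega>. Y u \<omega> - H \<omega> u (Y u \<omega>)))
        \<longrightarrow> (Y t, Y T) \<in> E)"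

end

theory Submission
  imports Defs
begin

text \<open>
  Given \<open>Y\<^sub>t\<close> and \<open>Z\<^sub>t\<close>, use the hedge \<open>Z\<^sub>t\<close> at time \<open>t\<close> and the zero hedge afterwards. The driver \<open>F\<close>
  then leads from \<open>Y\<^sub>t\<close> to a terminal value \<open>Q\<close>, so \<open>(Y\<^sub>t, Q)\<close> is an endpoint for \<open>F\<close> and hence for
  \<open>F'\<close>. After time \<open>t\<close> both drivers agree along the zero hedge, so by backward uniqueness the two
  solutions agree at time \<open>t + 1\<close>. Conditioning the equation of step \<open>t\<close> on \<open>\<F>\<^sub>t\<close> separates the
  driver from the martingale part and gives the equality of the driver values.

  An endpoint needs a solution on all of \<open>{0..T}\<close>, so the process has to be continued backwards from
  \<open>t\<close> to \<open>0\<close>. This uses that \<open>\<F>\<^sub>s\<close> is finite up to null sets: measurable functions are almost surely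
  functions of the history \<open>X\<^sub>0, \<dots>, X\<^sub>s\<close>, hence bounded and of the form \<open>W X\<^sub>s\<close> with \<open>W\<close> measurable
  at time \<open>s - 1\<close>.
\<close>

section \<open>Histories and the completed filtration\<close>

text \<open>The restriction fixes all later values to \<open>undefined\<close>, so histories up to
  \<open>t\<close> lie in an extensional product, which is finite for a process with finitely many
  states.\<close>

definition history :: "(nat \<Rightarrow> 'a \<Rightarrow> 'b) \<Rightarrow> nat \<Rightarrow> 'a \<Rightarrow> nat \<Rightarrow> 'b" where
  "history X t \<omega> = (\<lambda>s\<in>{..t}. X s \<omega>)"

lemma history_Suc: "history X (Suc t) \<omega> = (history X t \<omega>)(Suc t := X (Suc t) \<omega>)"
  by (auto simp: history_def fun_eq_iff)

lemma filt_generators: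
  "{X s -` B \<inter> space P | s B. s \<le> t \<and> B \<in> sets borel} \<union> null_sets (completion P) \<subseteq> Pow (space P)"
  using sets.sets_into_space[of _ "completion P"] by fastforce

lemma space_filt [simp]: "space (filt P X t) = space P"
  unfolding filt_def by (rule space_measure_of[OF filt_generators])

lemma sets_filt:
  "sets (filt P X t) = sigma_sets (space P)
     ({X s -` B \<inter> space P | s B. s \<le> t \<and> B \<in> sets borel} \<union> null_sets (completion P))"
  unfolding filt_def by (rule sets_measure_of[OF filt_generators])

lemma sets_filt_mono: "s \<le> t \<Longrightarrow> sets (filt P X s) \<subseteq> sets (filt P X t)"
  unfolding sets_filt by (rule sigma_sets_mono') force

lemma measurable_filt_mono:
  "f \<in> measurable (filt P X s) N \<Longrightarrow> s \<le> t \<Longrightarrow> f \<in> measurable (filt P X t) N"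
  using sets_filt_mono[of s t P X] by (auto simp: measurable_def)

lemma X_measurable_filt: "s \<le> t \<Longrightarrow> X s \<in> borel_measurable (filt P X t)"
  by (rule measurableI) (auto simp: sets_filt intro!: sigma_sets.Basic)

section \<open>Matrix products, measurability and bijections modulo null sets\<close>

lemma matrix_vector_mult_axis:
  fixes A :: "real^'n^'k"
  shows "A *v axis i 1 = (\<chi> k. A $ k $ i)"
  by (simp add: vec_eq_iff matrix_vector_mult_def axis_def if_distrib cong: if_cong)

lemma borel_measurable_vec_nth [measurable (raw)]:
  fixes f :: "'a \<Rightarrow> ('b::topological_space)^'i"
  assumes "f \<in> borel_measurable M"
  shows "(\<lambda>x. f x $ i) \<in> borel_measurable M"
  by (rule borel_measurable_continuous_on[OF _ assms]) (intro continuous_intros)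

lemma borel_measurable_vecI:
  fixes f :: "'a \<Rightarrow> real^'i"
  assumes "\<And>i. (\<lambda>x. f x $ i) \<in> borel_measurable M"
  shows "f \<in> borel_measurable M"
  by (subst borel_measurable_euclidean_space) (use assms in \<open>auto simp: Basis_vec_def inner_axis\<close>)

lemma borel_measurable_matrix_vector_mult:
  fixes A :: "'a \<Rightarrow> real^'n^'k"
  assumes [measurable]: "A \<in> borel_measurable M" "v \<in> borel_measurable M"
  shows "(\<lambda>\<omega>. A \<omega> *v v \<omega>) \<in> borel_measurable M"
  by (rule borel_measurable_vecI) (simp add: matrix_vector_mult_def)

lemma bij_mod_AE_surj:
  assumes "bij_mod_AE P A \<Phi>" "W \<in> A"
  obtains Y where "Y \<in> A" "AE \<omega> in P. \<Phi> Y \<omega> = W \<omega>"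
  using assms unfolding bij_mod_AE_def by meson

lemma bij_mod_AE_inj:
  assumes "bij_mod_AE P A \<Phi>" "Y \<in> A" "Y' \<in> A" "AE \<omega> in P. \<Phi> Y \<omega> = \<Phi> Y' \<omega>"
  shows "AE \<omega> in P. Y \<omega> = Y' \<omega>"
  using assms unfolding bij_mod_AE_def by meson

section \<open>Finiteness of the filtration modulo null sets\<close>

locale basis_valued_process = prob_space P
  for P :: "'a measure" +
  fixes X :: "nat \<Rightarrow> 'a \<Rightarrow> real^'n" and T :: nat
  assumes X_measurable: "s \<le> T \<Longrightarrow> X s \<in> borel_measurable P"
    and X_axis: "s \<le> T \<Longrightarrow> \<omega> \<in> space P \<Longrightarrow> X s \<omega> \<in> range (\<lambda>i. axis i 1)"
begin

definition histories :: "nat \<Rightarrow> (nat \<Rightarrow> real^'n) set" where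
  "histories t = (\<Pi>\<^sub>E s\<in>{..t}. range (\<lambda>i. axis i 1))"

lemma finite_histories: "finite (histories t)"
  unfolding histories_def by (rule finite_PiE) auto

lemma history_in_histories: "t \<le> T \<Longrightarrow> \<omega> \<in> space P \<Longrightarrow> history X t \<omega> \<in> histories t"
  using X_axis by (auto simp: history_def histories_def)

lemma measurable_history:
  assumes "t \<le> T"
  shows "history X t \<in> measurable (filt P X t) (count_space (histories t))"
proof (subst measurable_count_space_eq2[OF finite_histories], intro conjI ballI)
  show "history X t \<in> space (filt P X t) \<rightarrow> histories t"
    using history_in_histories[OF assms] by simp
  fix h assume h: "h \<in> histories t"
  have "history X t \<omega> = h \<longleftrightarrow> (\<forall>s\<in>{..t}. X s \<omega> = h s)" for \<omega>
    using h by (auto simp: history_def histories_def fun_eq_iff PiE_def extensional_def)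
  then have "history X t -` {h} \<inter> space (filt P X t)
      = (\<Inter>s\<in>{..t}. X s -` {h s} \<inter> space (filt P X t))"
    by auto
  also have "\<dots> \<in> sets (filt P X t)"
    by (intro sets.finite_INT measurable_sets[OF X_measurable_filt]) auto
  finally show "history X t -` {h} \<inter> space (filt P X t) \<in> sets (filt P X t)" .
qed

text \<open>The finite set of histories carries the discrete sigma-algebra, so \<open>g\<close> may
  be arbitrary.\<close>

lemma measurable_comp_history:
  assumes "t \<le> T"
  shows "(\<lambda>\<omega>. g (history X t \<omega>)) \<in> borel_measurable (filt P X t)"
  by (rule measurable_compose[OF measurable_history[OF assms]]) simp

text \<open>Induction over the generated sigma-algebra: a preimage under \<open>X s\<close> is
  decided by the history, a null set is almost surely empty, and complements and countable unions
  pass to \<open>B\<close>.\<close>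

lemma sets_filt_history:
  assumes "A \<in> sets (filt P X t)"
  shows "\<exists>B. AE \<omega> in P. \<omega> \<in> A \<longleftrightarrow> history X t \<omega> \<in> B"
  using assms unfolding sets_filt
proof (induction rule: sigma_sets.induct)
  case (Basic A)
  then consider s B where "A = X s -` B \<inter> space P" "s \<le> t" | "A \<in> null_sets (completion P)"
    by blast
  then show ?case
  proof cases
    case 1
    then have "AE \<omega> in P. \<omega> \<in> A \<longleftrightarrow> history X t \<omega> \<in> {h. h s \<in> B}"
      by (intro AE_I2) (auto simp: history_def)
    then show ?thesis by blast
  next
    case 2
    then have "AE \<omega> in P. \<omega> \<notin> A"
      using AE_not_in[OF 2] by (simp add: AE_completion_iff)
    then show ?thesis by (intro exI[of _ "{}"]) simp
  qed
next
  case Empty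
  then show ?case by (intro exI[of _ "{}"]) simp
next
  case (Compl A)
  then obtain B where "AE \<omega> in P. \<omega> \<in> A \<longleftrightarrow> history X t \<omega> \<in> B" by blast
  then have "AE \<omega> in P. \<omega> \<in> space P - A \<longleftrightarrow> history X t \<omega> \<in> - B"
    using AE_space by eventually_elim auto
  then show ?case by blast
next
  case (Union A)
  then obtain B where "\<And>i. AE \<omega> in P. \<omega> \<in> A i \<longleftrightarrow> history X t \<omega> \<in> B i" by metis
  then have "AE \<omega> in P. \<forall>i::nat. \<omega> \<in> A i \<longleftrightarrow> history X t \<omega> \<in> B i"
    by (simp add: AE_all_countable)
  then have "AE \<omega> in P. \<omega> \<in> \<Union>(range A) \<longleftrightarrow> history X t \<omega> \<in> \<Union>(range B)"
    by eventually_elim auto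
  then show ?case by blast
qed

text \<open>Outside a single null set the history decides membership of \<open>f \<omega>\<close> in
  every set of a countable basis. These sets separate points, so the history decides the value of
  \<open>f\<close> itself.\<close>

lemma measurable_filt_factor:
  fixes f :: "'a \<Rightarrow> 'b::{second_countable_topology, t1_space}"
  assumes f: "f \<in> borel_measurable (filt P X t)"
  obtains g where "AE \<omega> in P. f \<omega> = g (history X t \<omega>)"
proof -
  obtain D :: "'b set set" where D: "countable D" "topological_basis D"
    using ex_countable_basis by blast
  have "\<exists>B. AE \<omega> in P. \<omega> \<in> f -` U \<inter> space P \<longleftrightarrow> history X t \<omega> \<in> B" if "U \<in> D" for U
  proof (rule sets_filt_history)
    have "U \<in> sets borel"
      using topological_basis_open[OF D(2) that] by simp
    then show "f -` U \<inter> space P \<in> sets (filt P X t)"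
      using measurable_sets[OF f] by simp
  qed
  then obtain B where "\<And>U. U \<in> D \<Longrightarrow> AE \<omega> in P. \<omega> \<in> f -` U \<inter> space P \<longleftrightarrow> history X t \<omega> \<in> B U"
    by metis
  then have "AE \<omega> in P. \<forall>U\<in>D. \<omega> \<in> f -` U \<inter> space P \<longleftrightarrow> history X t \<omega> \<in> B U"
    using D(1) by (simp add: AE_ball_countable)
  then have *: "AE \<omega> in P. \<forall>U\<in>D. f \<omega> \<in> U \<longleftrightarrow> history X t \<omega> \<in> B U"
    using AE_space by eventually_elim auto
  \<comment> \<open>Almost all points are good; on good points \<open>f\<close> depends on the
    history alone.\<close>
  define good where "good \<omega> \<longleftrightarrow> (\<forall>U\<in>D. f \<omega> \<in> U \<longleftrightarrow> history X t \<omega> \<in> B U)" for \<omega>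
  have eq: "f \<omega> = f \<omega>'" if "good \<omega>" "good \<omega>'" "history X t \<omega> = history X t \<omega>'" for \<omega> \<omega>'
  proof (rule ccontr)
    assume "f \<omega> \<noteq> f \<omega>'"
    then obtain V where V: "open V" "f \<omega> \<in> V" "f \<omega>' \<notin> V"
      using t1_space[of "f \<omega>" "f \<omega>'"] by auto
    then obtain U where "U \<in> D" "f \<omega> \<in> U" "U \<subseteq> V"
      using topological_basisE[OF D(2)] by metis
    then show False using that V by (auto simp: good_def)
  qed
  show thesis
  proof
    \<comment> \<open>The factor evaluates \<open>f\<close> at some good point with the given
      history; when \<open>\<omega>\<close> is good, it is itself such a point.\<close>
    show "AE \<omega> in P. f \<omega> = (\<lambda>h. f (SOME \<omega>'. good \<omega>' \<and> history X t \<omega>' = h)) (history X t \<omega>)"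
      using *
    proof eventually_elim
      case (elim \<omega>)
      then have "good \<omega>" by (simp add: good_def)
      then have "good (SOME \<omega>'. good \<omega>' \<and> history X t \<omega>' = history X t \<omega>) \<and>
          history X t (SOME \<omega>'. good \<omega>' \<and> history X t \<omega>' = history X t \<omega>) = history X t \<omega>"
        by (intro someI[of "\<lambda>\<omega>'. good \<omega>' \<and> history X t \<omega>' = history X t \<omega>" \<omega>]) simp
      with \<open>good \<omega>\<close> show ?case by (metis eq)
    qed
  qed
qed

text \<open>There are finitely many histories, so the sum of the norms over all of them is a bound.
  This turns the merely measurable solutions provided by the driver bijection into bounded
  ones.\<close>

lemma Linfty_eq_measurable:
  assumes "t \<le> T"
  shows "Linfty P X t
    = (borel_measurable (filt P X t) :: ('a \<Rightarrow> 'b::{real_normed_vector, second_countable_topology}) set)"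
proof (intro equalityI subsetI)
  fix f :: "'a \<Rightarrow> 'b" assume f: "f \<in> borel_measurable (filt P X t)"
  then obtain g where "AE \<omega> in P. f \<omega> = g (history X t \<omega>)"
    by (rule measurable_filt_factor)
  then have "AE \<omega> in P. norm (f \<omega>) \<le> (\<Sum>h\<in>histories t. norm (g h))"
    using AE_space
  proof eventually_elim
    case (elim \<omega>)
    then show ?case
      using member_le_sum[OF history_in_histories[OF assms], of \<omega> "\<lambda>h. norm (g h)"] finite_histories by simp
  qed
  then show "f \<in> Linfty P X t" using f by (auto simp: Linfty_def)
qed (auto simp: Linfty_def)

text \<open>Since \<open>X (Suc s)\<close> is a basis vector, every function of it is linear: column
  \<open>i\<close> of \<open>W\<close> is the value of \<open>f\<close> predicted by the history up
  to \<open>s\<close> when the next state is \<open>axis i 1\<close>.\<close>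

lemma measurable_filt_representation:
  fixes f :: "'a \<Rightarrow> real^'k"
  assumes f: "f \<in> borel_measurable (filt P X (Suc s))" and s: "Suc s \<le> T"
  obtains W :: "'a \<Rightarrow> real^'n^'k"
  where "W \<in> borel_measurable (filt P X s)" "AE \<omega> in P. f \<omega> = W \<omega> *v X (Suc s) \<omega>"
proof -
  obtain g where g: "AE \<omega> in P. f \<omega> = g (history X (Suc s) \<omega>)"
    using f by (rule measurable_filt_factor)
  define W :: "'a \<Rightarrow> real^'n^'k"
    where "W \<omega> = (\<lambda>h. \<chi> k i. g (h(Suc s := axis i 1)) $ k) (history X s \<omega>)" for \<omega>
  show thesis
  proof
    show "W \<in> borel_measurable (filt P X s)"
      unfolding W_def by (rule measurable_comp_history) (use s in simp)
    show "AE \<omega> in P. f \<omega> = W \<omega> *v X (Suc s) \<omega>"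
      using g AE_space
    proof eventually_elim
      case (elim \<omega>)
      obtain i where "X (Suc s) \<omega> = axis i 1" using X_axis[OF s elim(2)] by auto
      then show ?case
        by (simp add: elim(1) history_Suc W_def matrix_vector_mult_axis)
    qed
  qed
qed

section \<open>Conditional expectations and martingale differences\<close>

lemma subalgebra_filt:
  assumes "t \<le> T"
  shows "subalgebra (completion P) (filt P X t)"
proof -
  have "X s -` B \<inter> space P \<in> sets (completion P)" if "s \<le> t" "B \<in> sets borel" for s B
    using measurable_sets[OF X_measurable, of s B] that assms by auto
  then have "sets (filt P X t) \<subseteq> sets (completion P)"
    unfolding sets_filt
    by (subst space_completion[symmetric], intro sets.sigma_sets_subset) (auto simp: null_sets_def)
  then show ?thesis by (simp add: subalgebra_def)
qed

lemma finite_measure_subalgebra_filt: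
  "t \<le> T \<Longrightarrow> finite_measure_subalgebra (completion P) (filt P X t)"
  by (intro finite_measure_subalgebra.intro finite_measure_subalgebra_axioms.intro
      prob_space.finite_measure prob_space_completion subalgebra_filt)

text \<open>The index is the time at which the prediction is known, one less than that of the
  predicted state.\<close>

definition predictor :: "nat \<Rightarrow> 'a \<Rightarrow> real^'n" where
  "predictor t \<omega> = (\<chi> i. real_cond_exp (completion P) (filt P X t) (\<lambda>\<omega>'. X (Suc t) \<omega>' $ i) \<omega>)"

lemma mart_diff_Suc: "mart_diff P X (Suc t) \<omega> = X (Suc t) \<omega> - predictor t \<omega>"
  by (simp add: mart_diff_def predictor_def)

lemma measurable_predictor: "predictor t \<in> borel_measurable (filt P X t)"
  by (rule borel_measurable_vecI) (simp add: predictor_def)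

lemma measurable_mart_diff: "mart_diff P X (Suc t) \<in> borel_measurable (filt P X (Suc t))"
proof -
  have "(\<lambda>\<omega>. X (Suc t) \<omega> - predictor t \<omega>) \<in> borel_measurable (filt P X (Suc t))"
    by (intro borel_measurable_diff X_measurable_filt measurable_filt_mono[OF measurable_predictor]) auto
  then show ?thesis by (simp add: mart_diff_Suc[abs_def])
qed

text \<open>Coordinates of basis vectors are bounded by 1, hence integrable; conditioning once more
  leaves the conditional expectation fixed, so the difference has conditional mean zero.\<close>

lemma mart_diff_nth:
  assumes "t < T"
  shows "integrable (completion P) (\<lambda>\<omega>. mart_diff P X (Suc t) \<omega> $ i)"
    and "AE \<omega> in completion P.
      real_cond_exp (completion P) (filt P X t) (\<lambda>\<omega>. mart_diff P X (Suc t) \<omega> $ i) \<omega> = 0"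
proof -
  interpret C: finite_measure_subalgebra "completion P" "filt P X t"
    using assms by (intro finite_measure_subalgebra_filt) simp
  let ?x = "\<lambda>\<omega>. X (Suc t) \<omega> $ i"
  let ?c = "real_cond_exp (completion P) (filt P X t)"
  have "AE \<omega> in completion P. norm (?x \<omega>) \<le> 1"
  proof (rule AE_I2)
    fix \<omega> assume "\<omega> \<in> space (completion P)"
    then obtain j where "X (Suc t) \<omega> = axis j 1" using X_axis[of "Suc t" \<omega>] assms by auto
    then show "norm (?x \<omega>) \<le> 1" by (simp add: axis_def)
  qed
  moreover have "X (Suc t) \<in> borel_measurable (completion P)"
    using assms by (intro measurable_completion X_measurable) simp
  ultimately have x: "integrable (completion P) ?x"
    by (intro C.integrable_const_bound) auto
  have cx: "integrable (completion P) (?c ?x)" by (rule C.real_cond_exp_int(1)[OF x])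
  have eq: "(\<lambda>\<omega>. mart_diff P X (Suc t) \<omega> $ i) = (\<lambda>\<omega>. ?x \<omega> - ?c ?x \<omega>)"
    by (simp add: mart_diff_Suc predictor_def)
  show "integrable (completion P) (\<lambda>\<omega>. mart_diff P X (Suc t) \<omega> $ i)"
    unfolding eq using x cx by simp
  show "AE \<omega> in completion P. ?c (\<lambda>\<omega>. mart_diff P X (Suc t) \<omega> $ i) \<omega> = 0"
    unfolding eq
    using C.real_cond_exp_diff[OF x cx] C.real_cond_exp_F_meas[OF cx borel_measurable_cond_exp]
    by eventually_elim simp
qed

text \<open>Conditioning on time \<open>t\<close> fixes \<open>D\<close>, while \<open>W\<close> can
  be pulled out of the product and the martingale difference has conditional mean zero. The argument
  runs component by component.\<close>

lemma mult_mart_diff_eq_adapted: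
  fixes D :: "'a \<Rightarrow> real^'k" and W :: "'a \<Rightarrow> real^'n^'k"
  assumes t: "t < T"
    and D: "D \<in> borel_measurable (filt P X t)" and W: "W \<in> borel_measurable (filt P X t)"
    and eq: "AE \<omega> in P. D \<omega> = W \<omega> *v mart_diff P X (Suc t) \<omega>"
  shows "AE \<omega> in P. D \<omega> = 0"
proof -
  interpret C: finite_measure_subalgebra "completion P" "filt P X t"
    using t by (intro finite_measure_subalgebra_filt) simp
  let ?c = "real_cond_exp (completion P) (filt P X t)"
  let ?M = "\<lambda>i \<omega>. mart_diff P X (Suc t) \<omega> $ i"
  note W [measurable] note D [measurable]
  have nth: "AE \<omega> in completion P. D \<omega> $ k = 0" for k
  proof -
    have Wi: "(\<lambda>\<omega>. W \<omega> $ k $ i) \<in> borel_measurable (filt P X t)" for i by measurable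
    have WM: "integrable (completion P) (\<lambda>\<omega>. W \<omega> $ k $ i * ?M i \<omega>)" for i
    proof -
      \<comment> \<open>Boundedness of the entries makes the products integrable, as required for
        pulling them out.\<close>
      have "(\<lambda>\<omega>. W \<omega> $ k $ i) \<in> Linfty P X t"
        using Linfty_eq_measurable Wi t by (metis less_imp_le)
      then obtain c where c: "AE \<omega> in P. norm (W \<omega> $ k $ i) \<le> c" by (auto simp: Linfty_def)
      have M: "integrable (completion P) (?M i)" by (rule mart_diff_nth(1)[OF t])
      show ?thesis
      proof (rule Bochner_Integration.integrable_bound)
        show "integrable (completion P) (\<lambda>\<omega>. c * ?M i \<omega>)" using M by simp
        have "(\<lambda>\<omega>. W \<omega> $ k $ i) \<in> borel_measurable (completion P)"
          by (rule measurable_from_subalg[OF C.subalg Wi])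
        then show "(\<lambda>\<omega>. W \<omega> $ k $ i * ?M i \<omega>) \<in> borel_measurable (completion P)"
          using borel_measurable_integrable[OF M] by simp
        show "AE \<omega> in completion P. norm (W \<omega> $ k $ i * ?M i \<omega>) \<le> norm (c * ?M i \<omega>)"
          using AE_completion[OF c]
          by eventually_elim (auto simp: abs_mult intro!: mult_right_mono)
      qed
    qed
    have sum: "integrable (completion P) (\<lambda>\<omega>. \<Sum>i\<in>UNIV. W \<omega> $ k $ i * ?M i \<omega>)"
      using WM by simp
    have eq': "AE \<omega> in completion P. D \<omega> $ k = (\<Sum>i\<in>UNIV. W \<omega> $ k $ i * ?M i \<omega>)"
      using AE_completion[OF eq] by eventually_elim (simp add: matrix_vector_mult_def)
    have Dk: "(\<lambda>\<omega>. D \<omega> $ k) \<in> borel_measurable (filt P X t)" by measurable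
    have Dk': "(\<lambda>\<omega>. D \<omega> $ k) \<in> borel_measurable (completion P)"
      by (rule measurable_from_subalg[OF C.subalg Dk])
    \<comment> \<open>Integrability of \<open>D\<close> is inherited from the sum it almost surely
      equals.\<close>
    have "integrable (completion P) (\<lambda>\<omega>. D \<omega> $ k)"
      using integrable_cong_AE[OF Dk' borel_measurable_integrable[OF sum] eq'] sum by simp
    then have 1: "AE \<omega> in completion P. ?c (\<lambda>\<omega>. D \<omega> $ k) \<omega> = D \<omega> $ k"
      by (rule C.real_cond_exp_F_meas[OF _ Dk])
    have 2: "AE \<omega> in completion P. ?c (\<lambda>\<omega>. D \<omega> $ k) \<omega> = ?c (\<lambda>\<omega>. \<Sum>i\<in>UNIV. W \<omega> $ k $ i * ?M i \<omega>) \<omega>"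
      by (rule C.real_cond_exp_cong[OF eq' Dk' borel_measurable_integrable[OF sum]])
    have 3: "AE \<omega> in completion P. ?c (\<lambda>\<omega>. \<Sum>i\<in>UNIV. W \<omega> $ k $ i * ?M i \<omega>) \<omega>
        = (\<Sum>i\<in>UNIV. ?c (\<lambda>\<omega>. W \<omega> $ k $ i * ?M i \<omega>) \<omega>)"
      by (rule C.real_cond_exp_sum[OF WM])
    have "AE \<omega> in completion P. ?c (\<lambda>\<omega>. W \<omega> $ k $ i * ?M i \<omega>) \<omega> = 0" for i
      using C.real_cond_exp_mult[OF Wi[of i] borel_measurable_integrable[OF mart_diff_nth(1)[OF t]] WM]
        mart_diff_nth(2)[OF t, of i]
      by eventually_elim simp
    then have 4: "AE \<omega> in completion P. \<forall>i. ?c (\<lambda>\<omega>. W \<omega> $ k $ i * ?M i \<omega>) \<omega> = 0"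
      by (simp add: AE_all_countable)
    show ?thesis using 1 2 3 4 by eventually_elim simp
  qed
  then have "AE \<omega> in completion P. \<forall>k. D \<omega> $ k = 0"
    by (simp add: AE_all_countable)
  then show ?thesis by (simp add: AE_completion_iff vec_eq_iff)
qed

text \<open>Uniqueness as for the Doob decomposition: \<open>A - A'\<close> is both adapted and a
  martingale increment, so it vanishes.\<close>

lemma mart_decomposition_unique:
  fixes A A' :: "'a \<Rightarrow> real^'k" and Z Z' :: "'a \<Rightarrow> real^'n^'k"
  assumes "t < T"
    and "A \<in> borel_measurable (filt P X t)" "A' \<in> borel_measurable (filt P X t)"
    and "Z \<in> borel_measurable (filt P X t)" "Z' \<in> borel_measurable (filt P X t)"
    and eq: "AE \<omega> in P. A \<omega> + Z \<omega> *v mart_diff P X (Suc t) \<omega>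
      = A' \<omega> + Z' \<omega> *v mart_diff P X (Suc t) \<omega>"
  shows "AE \<omega> in P. A \<omega> = A' \<omega>"
    and "AE \<omega> in P. Z \<omega> *v mart_diff P X (Suc t) \<omega> = Z' \<omega> *v mart_diff P X (Suc t) \<omega>"
proof -
  have "AE \<omega> in P. A \<omega> - A' \<omega> = 0"
  proof (rule mult_mart_diff_eq_adapted)
    show "AE \<omega> in P. A \<omega> - A' \<omega> = (Z' \<omega> - Z \<omega>) *v mart_diff P X (Suc t) \<omega>"
      using eq by eventually_elim (simp add: algebra_simps matrix_vector_mult_diff_rdistrib)
  qed (use assms in auto)
  then show *: "AE \<omega> in P. A \<omega> = A' \<omega>" by simp
  show "AE \<omega> in P. Z \<omega> *v mart_diff P X (Suc t) \<omega> = Z' \<omega> *v mart_diff P X (Suc t) \<omega>"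
    using * eq by eventually_elim simp
qed

section \<open>Regularity of drivers at a single time\<close>

lemma zero_in_Linfty: "(\<lambda>\<omega>. 0) \<in> Linfty P X t"
  by (auto simp: Linfty_def intro!: exI[of _ 0])

text \<open>The regularity conditions quantify over whole processes; extending by zero lets them be
  applied to a variable given at one time only.\<close>

lemma adapted_process_single:
  "W \<in> Linfty P X t \<Longrightarrow> adapted_process P X T (\<lambda>s. if s = t then W else (\<lambda>\<omega>. 0))"
  using zero_in_Linfty by (auto simp: adapted_process_def)

lemma regular_driver_measurable:
  fixes F :: "'a \<Rightarrow> nat \<Rightarrow> real^'k \<Rightarrow> real^'n^'k \<Rightarrow> real^'k"
  assumes "regular_driver P X T F" "t \<le> T" "Y \<in> Linfty P X t" "Z \<in> Linfty P X t"
  shows "(\<lambda>\<omega>. F \<omega> t (Y \<omega>) (Z \<omega>)) \<in> borel_measurable (filt P X t)"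
  using assms by (auto simp: regular_driver_def driver_def Linfty_def)

text \<open>Extensions by zero are equivalent as soon as they are so at time \<open>t\<close>, which
  localises the invariance of the driver under \<open>M_equiv\<close>.\<close>

lemma regular_driver_cong:
  fixes F :: "'a \<Rightarrow> nat \<Rightarrow> real^'k \<Rightarrow> real^'n^'k \<Rightarrow> real^'k"
  assumes F: "regular_driver P X T F" and t: "t < T"
    and Y: "Y \<in> Linfty P X t" and Z: "Z \<in> Linfty P X t" "Z' \<in> Linfty P X t"
    and eq: "AE \<omega> in P. Z \<omega> *v mart_diff P X (Suc t) \<omega> = Z' \<omega> *v mart_diff P X (Suc t) \<omega>"
  shows "AE \<omega> in P. F \<omega> t (Y \<omega>) (Z \<omega>) = F \<omega> t (Y \<omega>) (Z' \<omega>)"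
proof -
  let ?at = "\<lambda>W s. if s = t then W else (\<lambda>\<omega>. 0)"
  have "M_equiv P X T (?at Z) (?at Z')" using eq by (auto simp: M_equiv_def)
  then have "AE \<omega> in P. F \<omega> t (?at Y t \<omega>) (?at Z t \<omega>) = F \<omega> t (?at Y t \<omega>) (?at Z' t \<omega>)"
    using F t adapted_process_single[OF Y] adapted_process_single[OF Z(1)]
      adapted_process_single[OF Z(2)]
    unfolding regular_driver_def by blast
  then show ?thesis by simp
qed

lemma regular_driver_bij:
  fixes F :: "'a \<Rightarrow> nat \<Rightarrow> real^'k \<Rightarrow> real^'n^'k \<Rightarrow> real^'k"
  assumes F: "regular_driver P X T F" and t: "t < T" and Z: "Z \<in> Linfty P X t"
  shows "bij_mod_AE P (borel_measurable (filt P X t)) (\<lambda>Y \<omega>. Y \<omega> - F \<omega> t (Y \<omega>) (Z \<omega>))"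
proof -
  let ?Z = "\<lambda>s. if s = t then Z else (\<lambda>\<omega>. 0)"
  have "bij_mod_AE P (borel_measurable (filt P X t)) (\<lambda>Y \<omega>. Y \<omega> - F \<omega> t (Y \<omega>) (?Z t \<omega>))"
    using F t adapted_process_single[OF Z] unfolding regular_driver_def by blast
  then show ?thesis by simp
qed

section \<open>One-step equations and the construction of solutions\<close>

text \<open>The difference of the BSDE at \<open>u\<close> and at \<open>u + 1\<close>. It mentions
  no terminal value, so solutions can be built one step at a time in either direction.\<close>

definition bsde_step ::
  "('a \<Rightarrow> nat \<Rightarrow> real^'k \<Rightarrow> real^'n^'k \<Rightarrow> real^'k)
    \<Rightarrow> (nat \<Rightarrow> 'a \<Rightarrow> real^'k) \<Rightarrow> (nat \<Rightarrow> 'a \<Rightarrow> real^'n^'k) \<Rightarrow> nat \<Rightarrow> bool" where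
  "bsde_step F Y Z u \<longleftrightarrow> (AE \<omega> in P.
     Y u \<omega> - F \<omega> u (Y u \<omega>) (Z u \<omega>) + Z u \<omega> *v mart_diff P X (Suc u) \<omega> = Y (Suc u) \<omega>)"

text \<open>The sums telescope: at \<open>T\<close> they are empty and leave \<open>Y T\<close>, and
  each step passes between the equations at \<open>u\<close> and \<open>Suc u\<close>.\<close>

lemma bsde_solution_iff_steps:
  "bsde_solution P X T F Q Y Z \<longleftrightarrow>
     adapted_process P X T Y \<and> adapted_process P X T Z \<and>
     (AE \<omega> in P. Y T \<omega> = Q \<omega>) \<and> (\<forall>u<T. bsde_step F Y Z u)"
proof -
  define lhs where "lhs s \<omega> = Y s \<omega> - (\<Sum>u\<in>{s..<T}. F \<omega> u (Y u \<omega>) (Z u \<omega>))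
      + (\<Sum>u\<in>{s..<T}. Z u \<omega> *v mart_diff P X (u + 1) \<omega>)" for s \<omega>
  define eqn where "eqn s \<longleftrightarrow> (AE \<omega> in P. lhs s \<omega> = Q \<omega>)" for s
  have lhs: "lhs u \<omega> = (Y u \<omega> - F \<omega> u (Y u \<omega>) (Z u \<omega>) + Z u \<omega> *v mart_diff P X (Suc u) \<omega>
      - Y (Suc u) \<omega>) + lhs (Suc u) \<omega>" if "u < T" for u \<omega>
    by (simp add: lhs_def sum.atLeast_Suc_lessThan[OF that])
  have step: "bsde_step F Y Z u" if "u < T" "eqn u" "eqn (Suc u)" for u
    using that(2,3) unfolding eqn_def bsde_step_def
    by eventually_elim (simp add: lhs[OF that(1)])
  have eqn_step: "eqn u" if "u < T" "bsde_step F Y Z u" "eqn (Suc u)" for u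
    using that(2,3) unfolding eqn_def bsde_step_def
    by eventually_elim (simp add: lhs[OF that(1)])
  have T: "eqn T \<longleftrightarrow> (AE \<omega> in P. Y T \<omega> = Q \<omega>)" by (simp add: eqn_def lhs_def)
  have "(\<forall>s\<le>T. eqn s) \<longleftrightarrow> eqn T \<and> (\<forall>u<T. bsde_step F Y Z u)"
  proof (intro iffI conjI allI impI)
    fix s assume *: "eqn T \<and> (\<forall>u<T. bsde_step F Y Z u)" and "s \<le> T"
    from \<open>s \<le> T\<close> show "eqn s"
      by (induction rule: inc_induct) (use * eqn_step in auto)
  qed (use step in auto)
  then show ?thesis unfolding bsde_solution_def T by (simp add: eqn_def lhs_def)
qed

text \<open>Write \<open>y\<close> as \<open>W\<close> times the state, and split the state into
  predictor and martingale difference. The hedge \<open>W\<close> produces the martingale part, and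
  surjectivity of the driver bijection supplies an earlier value matching the predicted
  part.\<close>

lemma regular_driver_backward:
  fixes F :: "'a \<Rightarrow> nat \<Rightarrow> real^'k \<Rightarrow> real^'n^'k \<Rightarrow> real^'k"
  assumes F: "regular_driver P X T F" and "t \<le> T" and "y \<in> Linfty P X t"
  shows "\<exists>Y Z. Y t = y \<and> (\<forall>s\<le>t. Y s \<in> Linfty P X s) \<and> (\<forall>s<t. Z s \<in> Linfty P X s)
    \<and> (\<forall>s<t. bsde_step F Y Z s)"
  using assms(2,3)
proof (induction t arbitrary: y)
  case 0
  then show ?case by (intro exI[of _ "\<lambda>_. y"]) auto
next
  case (Suc t)
  have t: "t < T" "t \<le> T" using Suc.prems by auto
  have "y \<in> borel_measurable (filt P X (Suc t))" using Suc.prems by (simp add: Linfty_def)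
  then obtain W :: "'a \<Rightarrow> real^'n^'k" where W: "W \<in> borel_measurable (filt P X t)"
      "AE \<omega> in P. y \<omega> = W \<omega> *v X (Suc t) \<omega>"
    using measurable_filt_representation Suc.prems(1) by blast
  have W': "W \<in> Linfty P X t" using W(1) by (simp add: Linfty_eq_measurable[OF t(2)])
  have "(\<lambda>\<omega>. W \<omega> *v predictor t \<omega>) \<in> borel_measurable (filt P X t)"
    by (rule borel_measurable_matrix_vector_mult[OF W(1) measurable_predictor])
  then obtain x where x: "x \<in> borel_measurable (filt P X t)"
      "AE \<omega> in P. x \<omega> - F \<omega> t (x \<omega>) (W \<omega>) = W \<omega> *v predictor t \<omega>"
    by (rule bij_mod_AE_surj[OF regular_driver_bij[OF F t(1) W']])
  \<comment> \<open>Surjectivity only gives a measurable \<open>x\<close>; its boundedness comes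
    from the finiteness of the histories.\<close>
  have "x \<in> Linfty P X t" using x(1) by (simp add: Linfty_eq_measurable[OF t(2)])
  from Suc.IH[OF t(2) this] obtain Y Z where
    YZ: "Y t = x" "\<forall>s\<le>t. Y s \<in> Linfty P X s" "\<forall>s<t. Z s \<in> Linfty P X s" "\<forall>s<t. bsde_step F Y Z s"
    by blast
  \<comment> \<open>Steps before \<open>t\<close> read neither \<open>Y (Suc t)\<close> nor
    \<open>Z t\<close>, so these updates preserve them.\<close>
  define Y' Z' where "Y' = Y(Suc t := y)" and "Z' = Z(t := W)"
  have "bsde_step F Y' Z' t"
    unfolding bsde_step_def using W(2) x(2)
    by eventually_elim
      (simp add: Y'_def Z'_def YZ(1) mart_diff_Suc matrix_vector_mult_diff_distrib)
  moreover have "bsde_step F Y' Z' s" if "s < t" for s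
    using YZ(4) that by (auto simp: bsde_step_def Y'_def Z'_def)
  ultimately have "\<forall>s<Suc t. bsde_step F Y' Z' s"
    by (simp add: less_Suc_eq)
  moreover have "Y' (Suc t) = y" "\<forall>s\<le>Suc t. Y' s \<in> Linfty P X s" "\<forall>s<Suc t. Z' s \<in> Linfty P X s"
    using YZ W' Suc.prems(2) by (auto simp: Y'_def Z'_def less_Suc_eq le_Suc_eq)
  ultimately show ?case by blast
qed

text \<open>Read forwards, a step is an explicit formula for the next value, which is measurable and
  therefore bounded.\<close>

lemma regular_driver_forward:
  fixes F :: "'a \<Rightarrow> nat \<Rightarrow> real^'k \<Rightarrow> real^'n^'k \<Rightarrow> real^'k"
  assumes F: "regular_driver P X T F" and Z: "\<forall>s\<le>T. Z s \<in> Linfty P X s"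
    and Y: "\<forall>s\<le>t. Y s \<in> Linfty P X s" "\<forall>s<t. bsde_step F Y Z s"
    and "t \<le> m" "m \<le> T"
  shows "\<exists>Y'. Y' t = Y t \<and> (\<forall>s\<le>m. Y' s \<in> Linfty P X s) \<and> (\<forall>s<m. bsde_step F Y' Z s)"
  using assms(5,6)
proof (induction m rule: dec_induct)
  case base
  then show ?case using Y by blast
next
  case (step m)
  then obtain Y' where Y': "Y' t = Y t" "\<forall>s\<le>m. Y' s \<in> Linfty P X s" "\<forall>s<m. bsde_step F Y' Z s"
    by auto
  define y where "y \<omega> = Y' m \<omega> - F \<omega> m (Y' m \<omega>) (Z m \<omega>) + Z m \<omega> *v mart_diff P X (Suc m) \<omega>" for \<omega>
  have m: "m \<le> T" "Suc m \<le> T" using step.prems by auto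
  have L: "Y' m \<in> Linfty P X m" "Z m \<in> Linfty P X m" using Y' Z m by auto
  then have meas: "Y' m \<in> borel_measurable (filt P X m)" "Z m \<in> borel_measurable (filt P X m)"
    by (auto simp: Linfty_def)
  have "(\<lambda>\<omega>. Z m \<omega> *v mart_diff P X (Suc m) \<omega>) \<in> borel_measurable (filt P X (Suc m))"
    by (rule borel_measurable_matrix_vector_mult[OF measurable_filt_mono[OF meas(2)]
          measurable_mart_diff]) simp
  moreover have "Y' m \<in> borel_measurable (filt P X (Suc m))"
      "(\<lambda>\<omega>. F \<omega> m (Y' m \<omega>) (Z m \<omega>)) \<in> borel_measurable (filt P X (Suc m))"
    by (rule measurable_filt_mono[OF meas(1)] measurable_filt_mono[OF regular_driver_measurable[OF F m(1) L]],
        simp)+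
  ultimately have "y \<in> borel_measurable (filt P X (Suc m))"
    unfolding y_def[abs_def] by simp
  then have "y \<in> Linfty P X (Suc m)" by (simp add: Linfty_eq_measurable[OF m(2)])
  moreover define Y'' where "Y'' = Y'(Suc m := y)"
  ultimately have "Y'' t = Y t" "\<forall>s\<le>Suc m. Y'' s \<in> Linfty P X s"
    using Y' step.hyps by (auto simp: le_Suc_eq)
  moreover have "\<forall>s<Suc m. bsde_step F Y'' Z s"
    using Y'(3) by (auto simp: bsde_step_def Y''_def y_def less_Suc_eq)
  ultimately show ?case by blast
qed

section \<open>Comparison of two drivers and uniqueness\<close>

text \<open>Both steps decompose the same variable into adapted and martingale part, so the parts
  agree. Agreement of the martingale parts lets \<open>Z\<close> replace \<open>Z'\<close> inside
  \<open>F'\<close>, so that the conclusion evaluates both drivers at the same hedge.\<close>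

lemma bsde_step_decomposition_unique:
  fixes F F' :: "'a \<Rightarrow> nat \<Rightarrow> real^'k \<Rightarrow> real^'n^'k \<Rightarrow> real^'k"
  assumes F: "regular_driver P X T F" "regular_driver P X T F'" and u: "u < T"
    and L: "Y u \<in> Linfty P X u" "Y' u \<in> Linfty P X u" "Z u \<in> Linfty P X u" "Z' u \<in> Linfty P X u"
    and step: "bsde_step F Y Z u" "bsde_step F' Y' Z' u"
    and eq: "AE \<omega> in P. Y (Suc u) \<omega> = Y' (Suc u) \<omega>"
  shows "AE \<omega> in P. Y u \<omega> - F \<omega> u (Y u \<omega>) (Z u \<omega>) = Y' u \<omega> - F' \<omega> u (Y' u \<omega>) (Z u \<omega>)"
proof -
  have u': "u \<le> T" using u by simp
  have meas: "Y u \<in> borel_measurable (filt P X u)" "Y' u \<in> borel_measurable (filt P X u)"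
    "Z u \<in> borel_measurable (filt P X u)" "Z' u \<in> borel_measurable (filt P X u)"
    using L by (auto simp: Linfty_def)
  have A: "(\<lambda>\<omega>. Y u \<omega> - F \<omega> u (Y u \<omega>) (Z u \<omega>)) \<in> borel_measurable (filt P X u)"
    by (rule borel_measurable_diff[OF meas(1) regular_driver_measurable[OF F(1) u' L(1,3)]])
  have A': "(\<lambda>\<omega>. Y' u \<omega> - F' \<omega> u (Y' u \<omega>) (Z' u \<omega>)) \<in> borel_measurable (filt P X u)"
    by (rule borel_measurable_diff[OF meas(2) regular_driver_measurable[OF F(2) u' L(2,4)]])
  have "AE \<omega> in P. (Y u \<omega> - F \<omega> u (Y u \<omega>) (Z u \<omega>)) + Z u \<omega> *v mart_diff P X (Suc u) \<omega>
      = (Y' u \<omega> - F' \<omega> u (Y' u \<omega>) (Z' u \<omega>)) + Z' u \<omega> *v mart_diff P X (Suc u) \<omega>"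
    using step eq unfolding bsde_step_def by eventually_elim simp
  note * = mart_decomposition_unique[OF u A A' meas(3,4) this]
  show ?thesis
    using *(1) regular_driver_cong[OF F(2) u L(2,3,4) *(2)] by eventually_elim simp
qed

lemma generates_driver_unique:
  fixes F F' :: "'a \<Rightarrow> nat \<Rightarrow> real^'k \<Rightarrow> real^'n^'k \<Rightarrow> real^'k"
  assumes t: "t < T" and gen: "generates P X T t F H E" "generates P X T t F' H E"
    and y: "y \<in> Linfty P X t" and z: "z \<in> Linfty P X t"
  shows "AE \<omega> in P. F \<omega> t (y \<omega>) (z \<omega>) = F' \<omega> t (y \<omega>) (z \<omega>)"
proof -
  have F: "regular_driver P X T F" "regular_driver P X T F'"
    and H: "is_zero_hedging_function P X T F H" "is_zero_hedging_function P X T F' H"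
    and E: "endpoints P X T F t = E" "endpoints P X T F' t = E"
    using gen by (auto simp: generates_def)
  have zero: "AE \<omega> in P. F \<omega> u (x \<omega>) 0 = F' \<omega> u (x \<omega>) 0" if "x \<in> Linfty P X u" "u \<le> T" for u x
  proof -
    have "AE \<omega> in P. H \<omega> u (x \<omega>) = F \<omega> u (x \<omega>) 0" "AE \<omega> in P. H \<omega> u (x \<omega>) = F' \<omega> u (x \<omega>) 0"
      using H that by (auto simp: is_zero_hedging_function_def)
    then show ?thesis by eventually_elim simp
  qed

  obtain Y0 Z0 where 0: "Y0 t = y" "\<forall>s\<le>t. Y0 s \<in> Linfty P X s" "\<forall>s<t. Z0 s \<in> Linfty P X s"
      "\<forall>s<t. bsde_step F Y0 Z0 s"
    using regular_driver_backward[OF F(1) _ y] t by (metis less_imp_le)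
  \<comment> \<open>A step at \<open>s < t\<close> reads the hedge only at \<open>s\<close>, so the
    backward part survives the new values from \<open>t\<close> on.\<close>
  define Z where "Z s = (if s < t then Z0 s else if s = t then z else (\<lambda>\<omega>. 0))" for s
  have ZL: "\<forall>s\<le>T. Z s \<in> Linfty P X s"
    using 0(3) z zero_in_Linfty by (auto simp: Z_def)
  have "\<forall>s<t. bsde_step F Y0 Z s"
    using 0(4) by (simp add: bsde_step_def Z_def)
  then obtain Y where Y: "Y t = y" "\<forall>s\<le>T. Y s \<in> Linfty P X s" "\<forall>s<T. bsde_step F Y Z s"
    using regular_driver_forward[OF F(1) ZL 0(2), of T] t 0(1) by auto
  have "bsde_solution P X T F (Y T) Y Z"
    using Y ZL by (simp add: bsde_solution_iff_steps adapted_process_def)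
  \<comment> \<open>Equality of the endpoint sets yields a solution for \<open>F'\<close> with the
    same values at \<open>t\<close> and \<open>T\<close>, but with an unknown hedge
    \<open>Z'\<close>.\<close>
  then have "(y, Y T) \<in> endpoints P X T F' t"
    using Y E by (auto simp: endpoints_def)
  then obtain Y' Z' where Y': "Y' t = y" and "bsde_solution P X T F' (Y T) Y' Z'"
    by (auto simp: endpoints_def)
  then have sol: "\<forall>s\<le>T. Y' s \<in> Linfty P X s" "\<forall>s\<le>T. Z' s \<in> Linfty P X s"
      "AE \<omega> in P. Y T \<omega> = Y' T \<omega>" "\<forall>s<T. bsde_step F' Y' Z' s"
    by (auto simp: bsde_solution_iff_steps adapted_process_def eq_commute)
  have descend: "AE \<omega> in P. Y u \<omega> - F \<omega> u (Y u \<omega>) (Z u \<omega>) = Y' u \<omega> - F' \<omega> u (Y' u \<omega>) (Z u \<omega>)"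
    if "u < T" "AE \<omega> in P. Y (Suc u) \<omega> = Y' (Suc u) \<omega>" for u
    using that Y ZL sol by (intro bsde_step_decomposition_unique[OF F, where Z' = Z']) auto

  have "Suc t \<le> T" using t by simp
  then have "AE \<omega> in P. Y (Suc t) \<omega> = Y' (Suc t) \<omega>"
  proof (induction rule: inc_induct)
    case base
    then show ?case using sol(3) .
  next
    case (step u)
    \<comment> \<open>The induction descends from \<open>T\<close> to \<open>Suc t\<close>, so
      \<open>u\<close> lies strictly after \<open>t\<close>, where the hedge is zero.\<close>
    then have u: "u < T" "u \<le> T" and Zu: "Z u = (\<lambda>\<omega>. 0)" by (auto simp: Z_def)
    have L: "Y u \<in> Linfty P X u" "Y' u \<in> Linfty P X u" using Y sol u by auto
    \<comment> \<open>At the zero hedge \<open>F'\<close> may be replaced by \<open>F\<close>; both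
      sides are then images under one injective map.\<close>
    have eq: "AE \<omega> in P. Y u \<omega> - F \<omega> u (Y u \<omega>) 0 = Y' u \<omega> - F \<omega> u (Y' u \<omega>) 0"
      using descend[OF u(1) step.IH] zero[OF L(2) u(2)] by eventually_elim (simp add: Zu)
    have "Y u \<in> borel_measurable (filt P X u)" "Y' u \<in> borel_measurable (filt P X u)"
      using L by (simp_all add: Linfty_def)
    from bij_mod_AE_inj[OF regular_driver_bij[OF F(1) u(1) zero_in_Linfty] this eq]
    show ?case .
  qed
  \<comment> \<open>At time \<open>t\<close> both solutions equal \<open>y\<close>, which cancels
    and leaves the driver values at hedge \<open>z\<close>.\<close>
  from descend[OF t this] show ?thesis
    by eventually_elim (simp add: Y(1) Y' Z_def)
qed

end

theorem theorem5p3: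
  fixes P :: "'a measure"
    and X :: "nat \<Rightarrow> 'a \<Rightarrow> real^'n"
    and T t :: nat
    and H :: "'a \<Rightarrow> nat \<Rightarrow> real^'k \<Rightarrow> real^'k"
    and E :: "(('a \<Rightarrow> real^'k) \<times> ('a \<Rightarrow> real^'k)) set"
  assumes "prob_space P"
    and "T \<ge> 1"
    and "\<And>s. s \<le> T \<Longrightarrow> X s \<in> borel_measurable P"
    and "\<And>s \<omega>. s \<le> T \<Longrightarrow> \<omega> \<in> space P \<Longrightarrow> X s \<omega> \<in> range (\<lambda>i. axis i 1)"
    and "t < T"
    and "consistent_pair P X T t H E"
    and "\<exists>G :: 'a \<Rightarrow> nat \<Rightarrow> real^'k \<Rightarrow> real^'n^'k \<Rightarrow> real^'k. generates P X T t G H E"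
  shows "(\<exists>F :: 'a \<Rightarrow> nat \<Rightarrow> real^'k \<Rightarrow> real^'n^'k \<Rightarrow> real^'k. generates P X T t F H E) \<and>
    (\<forall>F F' :: 'a \<Rightarrow> nat \<Rightarrow> real^'k \<Rightarrow> real^'n^'k \<Rightarrow> real^'k.
       generates P X T t F H E \<and> generates P X T t F' H E \<longrightarrow>
       (\<forall>Y\<in>Linfty P X t. \<forall>Z\<in>Linfty P X t.
          AE \<omega> in P. F \<omega> t (Y \<omega>) (Z \<omega>) = F' \<omega> t (Y \<omega>) (Z \<omega>)))"
proof -
  interpret prob_space P by fact
  interpret basis_valued_process P X T
    using assms(3,4) by unfold_locales
  show ?thesis
    using assms(7) generates_driver_unique[OF assms(5)] by blast
qed

end
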